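(* Let $m$ and $k$ be nonnegative integers and let $\lambda$ be a partition of $m$. Then $$\sum_{\substack{|\mu|=k\\ \mu\subseteq\lambda}}C_{\lambda,\mu}(q)=\sum_{\substack{|\mu|=m-k\\ \mu\subseteq\lambda}}C_{\lambda,\mu}(q).$$ Equivalently, the polynomial $\sum_{\mu\subseteq\lambda}C_{\lambda,\mu}(q)T^{|\mu|}\in\mathbb N[q][T]$ is self-reciprocal (of degree $m$).
   Context: For partitions $\lambda,\mu$, $\lambda'$ is the conjugate partition ($\lambda'_i=\#\{j:\lambda_j\ge i\}$), $|\mu|=\sum\mu_i$, and $\mu\subseteq\lambda$ means $\mu_i\le\lambda_i$ for all $i$. With $(q)_k=(1-q)\cdots(1-q^k)$ and $\begin{bmatrix}n\\k\end{bmatrix}_q=\frac{(q)_n}{(q)_k(q)_{n-k}}$, define for $\mu\subseteq\lambda$ $$C_{\lambda,\mu}(q)=q^{\sum_{i\ge1}\mu'_{i+1}(\lambda'_i-\mu'_i)}\prod_{i\ge1}\begin{bmatrix}\lambda'_i-\mu'_{i+1}\\ \lambda'_i-\mu'_i\end{bmatrix}_q.$$ *)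

theory Defs
  imports "HOL-Computational_Algebra.Polynomial" "HOL-Library.Groups_Big_Fun"
begin

text \<open>
  A partition \<open>\<lambda>\<^sub>1 \<ge> \<lambda>\<^sub>2 \<ge> \<dots>\<close> is the function \<open>i \<mapsto> \<lambda>\<^sub>i\<^sub>+\<^sub>1\<close>; likewise
  \<open>conj_part lam i\<close> is \<open>\<lambda>'\<^sub>i\<^sub>+\<^sub>1\<close>. Containment \<open>\<mu> \<subseteq> \<lambda>\<close> is the pointwise order \<open>\<mu> \<le> lam\<close>.
\<close>

definition is_partition :: "(nat \<Rightarrow> nat) \<Rightarrow> bool" where
  "is_partition lam \<longleftrightarrow> antimono lam \<and> finite {i. lam i \<noteq> 0}"

definition part_size :: "(nat \<Rightarrow> nat) \<Rightarrow> nat" where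
  "part_size lam = Sum_any lam"

definition conj_part :: "(nat \<Rightarrow> nat) \<Rightarrow> nat \<Rightarrow> nat" where
  "conj_part lam i = card {j. i + 1 \<le> lam j}"

abbreviation qvar :: "int poly" where
  "qvar \<equiv> [:0, 1:]"

definition qfact :: "nat \<Rightarrow> int poly" where
  "qfact k = (\<Prod>i = 1..k. 1 - qvar ^ i)"

text \<open>
  The division is exact for \<open>k \<le> n\<close>, see \<open>qbinom_exact\<close> below.
\<close>

definition qbinom :: "nat \<Rightarrow> nat \<Rightarrow> int poly" where
  "qbinom n k = (if k \<le> n then qfact n div (qfact k * qfact (n - k)) else 0)"

text \<open>
  The terms of the sum and of the product are \<open>0\<close> and \<open>1\<close>, respectively, for all \<open>i \<ge> \<lambda>\<^sub>1\<close>.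
  For \<open>\<mu> \<subseteq> \<lambda>\<close> no subtraction truncates, and \<open>\<mu>'\<^sub>i\<^sub>+\<^sub>1 \<le> \<mu>'\<^sub>i\<close> puts the \<open>q\<close>-binomials in the
  range where the division is exact.
\<close>

definition C_poly :: "(nat \<Rightarrow> nat) \<Rightarrow> (nat \<Rightarrow> nat) \<Rightarrow> int poly" where
  "C_poly lam \<mu> =
     qvar ^ Sum_any (\<lambda>i. conj_part \<mu> (i + 1) * (conj_part lam i - conj_part \<mu> i)) *
     Prod_any (\<lambda>i. qbinom (conj_part lam i - conj_part \<mu> (i + 1))
                           (conj_part lam i - conj_part \<mu> i))"

definition subpartitions :: "(nat \<Rightarrow> nat) \<Rightarrow> (nat \<Rightarrow> nat) set" where
  "subpartitions lam = {\<mu>. is_partition \<mu> \<and> \<mu> \<le> lam}"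

text \<open>The polynomial in \<open>T\<close>, with coefficients in \<open>\<int>[q]\<close>.\<close>

definition C_genpoly :: "(nat \<Rightarrow> nat) \<Rightarrow> int poly poly" where
  "C_genpoly lam = (\<Sum>\<mu>\<in>subpartitions lam. monom (C_poly lam \<mu>) (part_size \<mu>))"

lemma finite_subpartitions:
  assumes "is_partition lam"
  shows "finite (subpartitions lam)"
proof -
  let ?S = "{i. lam i \<noteq> 0}"
  have S: "finite ?S" using assms by (simp add: is_partition_def)
  have "subpartitions lam \<subseteq>
      {f. \<forall>x. (x \<in> ?S \<longrightarrow> f x \<in> {..Max (lam ` ?S)}) \<and> (x \<notin> ?S \<longrightarrow> f x = 0)}"
  proof (intro subsetI CollectI allI conjI impI)
    fix \<mu> x assume m: "\<mu> \<in> subpartitions lam"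
    then have le: "\<mu> x \<le> lam x" by (simp add: subpartitions_def le_fun_def)
    { assume "x \<in> ?S"
      then have "lam x \<le> Max (lam ` ?S)" using S by (intro Max_ge) auto
      then show "\<mu> x \<in> {..Max (lam ` ?S)}" using le by simp }
    { assume "x \<notin> ?S" then show "\<mu> x = 0" using le by simp }
  qed
  then show ?thesis
    using finite_set_of_finite_funs[OF S, of "{..Max (lam ` ?S)}" 0] finite_subset by blast
qed

lemma qfact_0 [simp]: "qfact 0 = 1"
  by (simp add: qfact_def)

lemma qfact_Suc: "qfact (Suc k) = qfact k * (1 - qvar ^ Suc k)"
  by (simp add: qfact_def)

lemma qfact_nonzero [simp]: "qfact k \<noteq> 0"
proof -
  have "1 - qvar ^ i \<noteq> 0" if "i \<ge> 1" for i
  proof -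
    have "poly (1 - qvar ^ i) 2 = 1 - 2 ^ i" by simp
    moreover have "(2::int) ^ i \<noteq> 1" using that by simp
    ultimately show ?thesis by force
  qed
  then show ?thesis by (auto simp: qfact_def)
qed

lemma qfact_dvd: "qfact a * qfact b dvd qfact (a + b)"
proof (induction "a + b" arbitrary: a b)
  case 0
  then show ?case by simp
next
  case (Suc n)
  consider "a = 0" | "b = 0" | a' b' where "a = Suc a'" "b = Suc b'"
    by (metis not0_implies_Suc)
  then show ?case
  proof cases
    case 3
    obtain x where x: "qfact (a' + b) = qfact a' * qfact b * x"
      using Suc(1)[of a' b] Suc(2) 3 by (auto elim: dvdE)
    obtain y where y: "qfact (a + b') = qfact a * qfact b' * y"
      using Suc(1)[of a b'] Suc(2) 3 by (auto elim: dvdE)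
    have n: "a' + b = n" "a + b' = n" using Suc(2) 3 by auto
    have "qfact (a + b) = qfact n * (1 - qvar ^ (a + b))"
      using Suc(2) by (metis qfact_Suc)
    also have "\<dots> = qfact n * (1 - qvar ^ a) + qfact n * qvar ^ a * (1 - qvar ^ b)"
      by (simp add: algebra_simps power_add)
    also have "\<dots> = (qfact a' * (1 - qvar ^ a)) * qfact b * x
                   + qfact a * (qfact b' * (1 - qvar ^ b)) * (y * qvar ^ a)"
      using x y n by (simp add: mult_ac)
    also have "\<dots> = qfact a * qfact b * (x + y * qvar ^ a)"
      unfolding 3 qfact_Suc[symmetric] by (simp add: distrib_left mult_ac)
    finally show ?thesis by simp
  qed simp_all
qed

lemma qbinom_exact:
  assumes "k \<le> n"
  shows "qbinom n k * (qfact k * qfact (n - k)) = qfact n"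
  using qfact_dvd[of k "n - k"] assms by (simp add: qbinom_def)

end

(* C_{lam,mu}(p) counts the subgroups of type mu in a finite abelian p-group G = Z/p^r + H of type
   lam, where p^r is the exponent of G. A subgroup lies in pZ/p^r + H, or it contains some (1,h)
   and is then determined by its intersection with H and by h modulo this intersection.
   As polynomial identities: if lam- is lam with its last row of length r = lam_1 shortened by one,
   and nu is lam with one row of length r removed, then
     N(lam, k) = N(lam-, k) + q^(m-k) N(nu, k-r),
   and by the q-Pascal rule this holds term by term in mu. From this recurrence alone the dual one
     N(lam, k) = N(lam-, k-1) + q^k N(nu, k)
   follows by induction, and the two recurrences are exchanged by k |-> m-k. *)

theory Submission
  imports Defs "HOL-Library.FuncSet"
begin

section \<open>The recurrence on columns\<close>

text \<open>
  The list holds the column lengths \<open>\<lambda>'\<^sub>r, \<dots>, \<lambda>'\<^sub>1\<close>, shortest first; indexing by integers makes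
  the value \<open>0\<close> outside of \<open>0 \<le> k \<le> m\<close>, where \<open>nat\<close> would truncate the exponent.
\<close>
function subcount :: "nat list \<Rightarrow> int \<Rightarrow> int poly" where
  "subcount [] k = (if k = 0 then 1 else 0)"
| "subcount (0 # cs) k = subcount cs k"
| "subcount (Suc c # cs) k = subcount (c # cs) k +
     qvar ^ nat (int (sum_list (Suc c # cs)) - k) *
     subcount (c # map (\<lambda>x. x - 1) cs) (k - int (Suc (length cs)))"
  by pat_completeness auto
termination
\<comment> \<open>Dropping an empty column keeps the sum but shortens the list; the other two calls
  keep the length and lower the sum.\<close>
proof (relation "measure (\<lambda>(cs, k). sum_list cs + length cs)", goal_cases)
  case (4 c cs k)
  have "sum_list (map (\<lambda>x. x - 1) cs) \<le> sum_list cs"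
    by (induction cs) auto
  then show ?case by simp
qed auto

lemma sum_list_pred:
  assumes "\<forall>x\<in>set cs. 0 < (x :: nat)"
  shows "sum_list (map (\<lambda>x. x - 1) cs) + length cs = sum_list cs"
  using assms by (induction cs) auto

lemma sorted_pred: "sorted (cs :: nat list) \<Longrightarrow> sorted (map (\<lambda>x. x - 1) cs)"
  by (induction cs) (auto simp: diff_le_mono)

text \<open>Lowering only the head is the passage to lam-, lowering every entry the passage to nu. A
  sorted list with positive head has only positive entries, so the truncated subtraction really
  takes one off each.\<close>

lemma sorted_Suc_ConsD:
  assumes "sorted (Suc c # cs)"
  shows "sorted (c # cs)" "sorted (c # map (\<lambda>x. x - 1) cs)"
    "sum_list (map (\<lambda>x. x - 1) cs) + length cs = sum_list cs"
proof -
  show "sorted (c # cs)" using assms by fastforce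
  show "sorted (c # map (\<lambda>x. x - 1) cs)"
    using assms sorted_pred[of cs] by fastforce
  show "sum_list (map (\<lambda>x. x - 1) cs) + length cs = sum_list cs"
    using assms by (intro sum_list_pred) fastforce
qed

text \<open>An index outside the range stays outside in both recursive calls. This is what makes the
  truncation by \<open>nat\<close> in the exponents harmless later on.\<close>

lemma subcount_eq_0:
  assumes "sorted cs" "k < 0 \<or> int (sum_list cs) < k"
  shows "subcount cs k = 0"
  using assms
proof (induction cs k rule: subcount.induct)
  case (3 c cs k)
  note s = sorted_Suc_ConsD[OF 3(3)]
  have "k < 0 \<or> int (sum_list (c # cs)) < k"
    and "k - int (Suc (length cs)) < 0 \<or>
      int (sum_list (c # map (\<lambda>x. x - 1) cs)) < k - int (Suc (length cs))"
    using 3(4) s(3) by auto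
  then show ?case using 3(1)[OF s(1)] 3(2)[OF s(2)] by simp
qed auto

text \<open>The row-removal term has a negative index and vanishes. By symmetry the value 1 is also
  the leading coefficient, which will fix the degree.\<close>

lemma subcount_0:
  assumes "sorted cs"
  shows "subcount cs 0 = 1"
  using assms
proof (induction cs "0 :: int" rule: subcount.induct)
  case (3 c cs)
  note s = sorted_Suc_ConsD[OF 3(3)]
  show ?case using 3(1)[OF s(1)] subcount_eq_0[OF s(2)] by simp
qed auto

text \<open>Positivity is visible in the recurrence, which has no subtraction of polynomials, while
  the division in \<open>qbinom\<close> hides it.\<close>

lemma subcount_nonneg: "0 \<le> coeff (subcount cs k) j"
proof (induction cs k arbitrary: j rule: subcount.induct)
  case (3 c cs k)
  have "qvar ^ n = monom 1 n" for n
    by (simp add: monom_altdef)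
  then show ?case using 3 unfolding subcount.simps by (simp only: coeff_add coeff_monom_mult) simp
qed (auto simp: coeff_1)

text \<open>
  Dual to the defining recurrence; the two together give the symmetry. The induction hypothesis
  is applied to both terms of the defining recurrence, which is then used backwards twice.
\<close>
lemma subcount_dual:
  assumes "sorted (Suc c # cs)"
  shows "subcount (Suc c # cs) k =
    subcount (c # cs) (k - 1) + qvar ^ nat k * subcount (c # map (\<lambda>x. x - 1) cs) k"
  using assms
proof (induction "c + sum_list cs + length cs" arbitrary: c cs k rule: less_induct)
  case less
  note s = sorted_Suc_ConsD[OF less(2)]
  let ?p = "map (\<lambda>x :: nat. x - 1)"
  \<comment> \<open>For \<open>c = 0\<close> the lowered head is an empty column, which the
    recursion drops; by sortedness the next column is then positive.\<close>
  consider (a) "c = 0" "cs = []" | (b) d ds where "c = 0" "cs = Suc d # ds" | (c) e where "c = Suc e"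
    using less(2) by (cases c; cases cs) (auto simp: Suc_le_eq gr0_conv_Suc)
  then show ?case
  proof cases
    case a
    then show ?thesis by simp
  next
    case b
    have "sorted (Suc d # ds)" using s(1) b by simp
    note IH = less(1)[OF _ this]
    \<comment> \<open>Compared with the whole list, \<open>cs\<close> has sum and length one
      smaller. Its defining recurrence at \<open>k - 1\<close> therefore has the same exponent and
      the same shifted index as that of the whole list at \<open>k\<close>.\<close>
    show ?thesis using s(3) IH[of k] b
      by (simp add: algebra_simps)
  next
    case c
    note s' = sorted_Suc_ConsD[OF s(1)[unfolded c]] sorted_Suc_ConsD[OF s(2)[unfolded c]]
    have IH1: "subcount (Suc e # cs) k = subcount (e # cs) (k - 1)
        + qvar ^ nat k * subcount (e # ?p cs) k"
      by (rule less(1)) (use c s in auto)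
    define k' where "k' = k - int (Suc (length cs))"
    have IH2: "subcount (Suc e # ?p cs) k' = subcount (e # ?p cs) (k' - 1)
        + qvar ^ nat k' * subcount (e # ?p (?p cs)) k'"
      by (rule less(1)) (use c s in auto)
    define M where "M = int (sum_list (Suc c # cs))"
    have A: "subcount (Suc e # cs) (k - 1) = subcount (e # cs) (k - 1)
        + qvar ^ nat (M - k) * subcount (e # ?p cs) (k' - 1)"
      by (simp add: c M_def k'_def algebra_simps)
    have B: "subcount (Suc e # ?p cs) k = subcount (e # ?p cs) k
        + qvar ^ nat (M - int (Suc (length cs)) - k) * subcount (e # ?p (?p cs)) k'"
    proof -
      have "int (sum_list (Suc e # ?p cs)) = M - int (Suc (length cs))"
        using s(3) by (simp add: c M_def)
      then show ?thesis unfolding subcount.simps k'_def by (simp only: length_map list.map_comp)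
    qed
    \<comment> \<open>Without truncation both exponents add up to \<open>M\<close> minus the number
      of columns. If \<open>k'\<close> is in range, no \<open>nat\<close> truncates; otherwise the
      common factor is 0.\<close>
    have C: "qvar ^ nat (M - k) * (qvar ^ nat k' * subcount (e # ?p (?p cs)) k') =
        qvar ^ nat k * (qvar ^ nat (M - int (Suc (length cs)) - k) * subcount (e # ?p (?p cs)) k')"
    proof (cases "k' < 0 \<or> int (sum_list (e # ?p (?p cs))) < k'")
      case True
      then show ?thesis using subcount_eq_0[OF s'(5)] by simp
    next
      case False
      have "nat (M - k) + nat k' = nat k + nat (M - int (Suc (length cs)) - k)"
        using False s'(6) s(3) by (auto simp: M_def c k'_def)
      then show ?thesis unfolding mult.assoc[symmetric] power_add[symmetric] by simp
    qed
    have "subcount (Suc c # cs) k = subcount (Suc e # cs) k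
        + qvar ^ nat (M - k) * subcount (Suc e # ?p cs) k'"
      by (simp only: c M_def k'_def subcount.simps(3)[of "Suc e"])
    also have "\<dots> = subcount (Suc e # cs) (k - 1) + qvar ^ nat k * subcount (Suc e # ?p cs) k"
      unfolding IH1 IH2 A B distrib_left C by (simp only: add_ac)
    finally show ?thesis by (simp only: c)
  qed
qed

lemma subcount_sym:
  assumes "sorted cs"
  shows "subcount cs (int (sum_list cs) - k) = subcount cs k"
  using assms
proof (induction cs k rule: subcount.induct)
  case (3 c cs k)
  note s = sorted_Suc_ConsD[OF 3(3)]
  define M where "M = int (sum_list (Suc c # cs))"
  \<comment> \<open>Reflection in the smaller lists sends the two indices of the defining recurrence
    at \<open>k\<close> to \<open>M - k - 1\<close> and \<open>M - k\<close>, which are the indices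
    of the dual recurrence at \<open>M - k\<close>.\<close>
  have 1: "int (sum_list (c # cs)) - k = M - k - 1" by (simp add: M_def)
  have 2: "int (sum_list (c # map (\<lambda>x. x - 1) cs)) - (k - int (Suc (length cs))) = M - k"
    using s(3) by (simp add: M_def)
  show ?case
    using 3(1)[OF s(1)] 3(2)[OF s(2)] unfolding 1 2
    unfolding M_def[symmetric] subcount_dual[OF 3(3), of "M - k"]
      subcount.simps(3)[of c cs k, folded M_def] by simp
qed auto

section \<open>Conjugate partitions\<close>

lemma is_partitionD: "is_partition lam \<Longrightarrow> i \<le> j \<Longrightarrow> lam j \<le> lam i"
  by (simp add: is_partition_def antimonoD)

text \<open>Both sides say that the box in row i and column j lies in the Young diagram: the rows
  longer than j form an initial segment. Most facts on conjugates below are read off from this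
  equivalence.\<close>

lemma conj_part_less_iff:
  assumes "is_partition lam"
  shows "i < conj_part lam j \<longleftrightarrow> j < lam i"
proof -
  note anti = is_partitionD[OF assms]
  have fin: "finite {i. lam i \<noteq> 0}"
    using assms by (simp add: is_partition_def)
  let ?S = "{i. j + 1 \<le> lam i}"
  have finS: "finite ?S" by (rule finite_subset[OF _ fin]) auto
  show ?thesis
  proof
    assume "j < lam i"
    then have "{..i} \<subseteq> ?S" using anti[of _ i] by (auto simp: Suc_le_eq order.strict_trans2)
    then have "card {..i} \<le> card ?S" using finS by (intro card_mono)
    then show "i < conj_part lam j" by (simp add: conj_part_def)
  next
    assume l: "i < conj_part lam j"
    show "j < lam i"
    proof (rule ccontr)
      assume n: "\<not> j < lam i"
      have "?S \<subseteq> {..<i}"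
      proof
        fix x assume x: "x \<in> ?S"
        show "x \<in> {..<i}"
        proof (rule ccontr)
          assume "x \<notin> {..<i}"
          then have "lam x \<le> lam i" using anti by simp
          then show False using x n by simp
        qed
      qed
      then have "card ?S \<le> card {..<i}" by (intro card_mono) auto
      then show False using l by (simp add: conj_part_def)
    qed
  qed
qed

lemma nat_eqI_less: "(\<And>i. i < a \<longleftrightarrow> i < b) \<Longrightarrow> a = (b :: nat)"
  by (meson linorder_neqE_nat less_irrefl)

lemma conj_part_antimono:
  assumes "is_partition lam"
  shows "antimono (conj_part lam)"
proof (rule antimonoI)
  fix i j :: nat assume "i \<le> j"
  then show "conj_part lam j \<le> conj_part lam i"
    using conj_part_less_iff[OF assms, of "conj_part lam i" i]
      conj_part_less_iff[OF assms, of "conj_part lam i" j] by linarith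
qed

lemma conj_part_mono:
  assumes "is_partition \<mu>" "is_partition lam" "\<mu> \<le> lam"
  shows "conj_part \<mu> i \<le> conj_part lam i"
  using conj_part_less_iff[OF assms(1), of "conj_part lam i" i] le_funD[OF assms(3)]
    conj_part_less_iff[OF assms(2), of "conj_part lam i" i] by (meson leI less_irrefl order.strict_trans2)

lemma conj_part_eq_0: "is_partition lam \<Longrightarrow> lam 0 \<le> i \<Longrightarrow> conj_part lam i = 0"
  by (meson conj_part_less_iff gr0I leD)

text \<open>Double counting of the boxes, by rows and by columns. The bound \<open>n\<close> may
  exceed the first part, so that a partition and its subpartitions can be summed over the same
  columns.\<close>

lemma part_size_conj:
  assumes "is_partition lam" "lam 0 \<le> n"
  shows "part_size lam = (\<Sum>i<n. conj_part lam i)"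
proof -
  have le: "lam j \<le> n" for j
    using is_partitionD[OF assms(1), of 0 j] assms(2) by simp
  let ?J = "{..<conj_part lam 0}"
  have c: "conj_part lam i \<le> conj_part lam 0" for i
    using antimonoD[OF conj_part_antimono[OF assms(1)], of 0 i] by simp
  have "part_size lam = sum lam ?J"
    unfolding part_size_def
    by (rule Sum_any.expand_superset) (auto simp: conj_part_less_iff[OF assms(1)])
  also have "\<dots> = (\<Sum>j\<in>?J. \<Sum>i<n. if i < lam j then 1 else 0)"
  proof (rule sum.cong[OF refl])
    fix j
    have "{..<n} \<inter> {i. i < lam j} = {..<lam j}" using le[of j] by auto
    then show "lam j = (\<Sum>i<n. if i < lam j then 1 else 0)"
      by (simp add: sum.If_cases)
  qed
  also have "\<dots> = (\<Sum>i<n. \<Sum>j\<in>?J. if j < conj_part lam i then 1 else 0)"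
    by (subst sum.swap) (simp add: conj_part_less_iff[OF assms(1)])
  also have "\<dots> = (\<Sum>i<n. conj_part lam i)"
  proof (rule sum.cong[OF refl])
    fix i
    have "?J \<inter> {j. j < conj_part lam i} = {..<conj_part lam i}" using c[of i] by auto
    then show "(\<Sum>j\<in>?J. if j < conj_part lam i then 1 else 0) = conj_part lam i"
      by (simp add: sum.If_cases)
  qed
  finally show ?thesis .
qed

section \<open>Removing a row and removing a corner\<close>

lemma is_partition_shift:
  assumes "is_partition lam"
  shows "is_partition (lam \<circ> Suc)"
proof -
  have "finite (Suc -` {i. lam i \<noteq> 0})"
    using assms by (intro finite_vimageI) (auto simp: is_partition_def)
  then show ?thesis using is_partitionD[OF assms]
    by (simp add: is_partition_def vimage_def antimono_def monotone_on_def)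
qed

lemma conj_part_shift:
  assumes "is_partition lam"
  shows "conj_part (lam \<circ> Suc) i = conj_part lam i - 1"
  by (rule nat_eqI_less)
    (use conj_part_less_iff[OF assms] conj_part_less_iff[OF is_partition_shift[OF assms]]
      in \<open>simp add: less_diff_conv\<close>)

text \<open>This is lam- for nonempty \<open>lam\<close>: \<open>conj_part lam (lam 0 - 1)\<close>
  counts the rows of maximal length, and one less is the zero-based index of the last of them, which
  ends in a corner.\<close>

definition remove_box :: "(nat \<Rightarrow> nat) \<Rightarrow> nat \<Rightarrow> nat" where
  "remove_box lam = lam (conj_part lam (lam 0 - 1) - 1 := lam 0 - 1)"

lemma remove_box:
  assumes "is_partition lam" "lam 0 = Suc r"
  shows "is_partition (remove_box lam)"
    and "conj_part (remove_box lam) = (conj_part lam)(r := conj_part lam r - 1)"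
    and "remove_box lam 0 \<le> Suc r"
proof -
  note l = conj_part_less_iff[OF assms(1)]
  define c where "c = conj_part lam r - 1"
  have "0 < conj_part lam r" using l assms by simp
  then have c: "conj_part lam r = Suc c" by (simp add: c_def)
  have rb: "remove_box lam = lam (c := r)" using assms by (simp add: remove_box_def c_def)
  have anti: "lam i \<ge> lam j" if "i \<le> j" for i j
    using is_partitionD[OF assms(1) that] .
  have le: "lam i \<le> Suc r" for i using anti[of 0 i] assms by simp
  have lamc: "lam i = Suc r" if "i \<le> c" for i
    using l[of i r] le[of i] that c by simp
  have lamgt: "lam i \<le> r" if "c < i" for i
    using l[of i r] that c by simp
  have "finite {i. (lam (c := r)) i \<noteq> 0}"
    by (rule finite_subset[of _ "insert c {i. lam i \<noteq> 0}"]) (use assms in \<open>auto simp: is_partition_def\<close>)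
  moreover have "antimono (lam (c := r))"
    by (rule antimonoI) (use lamc lamgt anti in \<open>auto simp: order.strict_iff_order\<close>)
  ultimately show p: "is_partition (remove_box lam)" by (simp add: is_partition_def rb)
  \<comment> \<open>The bound stays at \<open>Suc r\<close> even if no row of that length is left:
    lam- keeps the same number of columns, the last one possibly empty.\<close>
  show "remove_box lam 0 \<le> Suc r" using le by (simp add: rb)
  show "conj_part (remove_box lam) = (conj_part lam)(r := conj_part lam r - 1)"
  proof (rule ext, rule nat_eqI_less)
    fix j i
    show "i < conj_part (remove_box lam) j \<longleftrightarrow> i < ((conj_part lam)(r := conj_part lam r - 1)) j"
      using l[of i j] lamc[of i] lamgt[of i] c
      unfolding conj_part_less_iff[OF p] by (auto simp: rb)
  qed
qed

text \<open>Only the shortened row can violate containment, and \<mu> contains the removed box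
  exactly when its column \<open>r\<close> is as long as that of \<open>lam\<close>.\<close>

lemma le_remove_box_iff:
  assumes "is_partition lam" "lam 0 = Suc r" "is_partition \<mu>" "\<mu> \<le> lam"
  shows "\<mu> \<le> remove_box lam \<longleftrightarrow> conj_part \<mu> r < conj_part lam r"
proof -
  note l = conj_part_less_iff[OF assms(1)] and m = conj_part_less_iff[OF assms(3)]
  have pos: "0 < conj_part lam r" using l assms by simp
  have "\<mu> \<le> remove_box lam \<longleftrightarrow> \<mu> (conj_part lam r - 1) \<le> r"
    using assms(4) by (auto simp: remove_box_def assms(2) le_fun_def)
  also have "\<dots> \<longleftrightarrow> \<not> conj_part lam r - 1 < conj_part \<mu> r"
    unfolding m by auto
  finally show ?thesis using pos by auto
qed

section \<open>The recurrence for the subgroup-counting sums\<close>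

lemma qbinom_0 [simp]: "qbinom n 0 = 1"
  by (simp add: qbinom_def)

lemma qbinom_self [simp]: "qbinom n n = 1"
  by (simp add: qbinom_def)

text \<open>The q-Pascal rule. Multiplied by the common denominator \<open>D\<close> it becomes 1 -
  xy = (1 - x) + x(1 - y) with x = q^(k+1) and y = q^(n-k).\<close>

lemma qbinom_Suc_Suc:
  assumes "k < n"
  shows "qbinom (Suc n) (Suc k) = qbinom n k + qvar ^ Suc k * qbinom n (Suc k)"
proof -
  define b where "b = n - Suc k"
  have n: "n = Suc (k + b)" using assms by (simp add: b_def)
  define D where "D = qfact (Suc k) * qfact (Suc b)"
  have e1: "qbinom (Suc n) (Suc k) * D = qfact (Suc n)"
    using qbinom_exact[of "Suc k" "Suc n"] by (simp add: n D_def)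
  have e2: "qbinom n k * D = qfact n * (1 - qvar ^ Suc k)"
    using qbinom_exact[of k n] by (simp add: n D_def qfact_Suc[of k] mult_ac)
  have e3: "qbinom n (Suc k) * D = qfact n * (1 - qvar ^ Suc b)"
    using qbinom_exact[of "Suc k" n] by (simp add: n D_def qfact_Suc[of b] mult_ac)
  have factor: "f * (1 - x * y) = f * (1 - x) + x * (f * (1 - y))" for f x y :: "int poly"
    by (simp add: algebra_simps)
  have "qvar ^ Suc n = qvar ^ Suc k * qvar ^ Suc b"
    by (simp add: n flip: power_add)
  then have "qfact (Suc n) = qfact n * (1 - qvar ^ Suc k * qvar ^ Suc b)"
    by (simp only: qfact_Suc)
  then have "qbinom (Suc n) (Suc k) * D = (qbinom n k + qvar ^ Suc k * qbinom n (Suc k)) * D"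
    unfolding distrib_right mult.assoc e1 e2 e3
    using factor[of "qfact n" "qvar ^ Suc k" "qvar ^ Suc b"] by (simp only:)
  moreover have "D \<noteq> 0" by (simp add: D_def)
  ultimately show ?thesis by simp
qed

text \<open>Beyond the columns of \<open>lam\<close> all differences are 0. The freedom in
  \<open>n\<close> allows \<open>lam\<close>, lam- and nu to be compared over the same
  columns.\<close>

lemma C_poly_eq:
  assumes "is_partition lam" "is_partition \<mu>" "\<mu> \<le> lam" "lam 0 \<le> n"
  shows "C_poly lam \<mu> =
    qvar ^ (\<Sum>i<n. conj_part \<mu> (i + 1) * (conj_part lam i - conj_part \<mu> i)) *
    (\<Prod>i<n. qbinom (conj_part lam i - conj_part \<mu> (i + 1)) (conj_part lam i - conj_part \<mu> i))"
proof -
  have z: "conj_part lam i = 0" if "n \<le> i" for i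
    using that conj_part_eq_0[OF assms(1)] assms(4) by simp
  have "i < n" if "conj_part lam i \<noteq> 0" for i
    using z[of i] that by (meson leI)
  then show ?thesis
    unfolding C_poly_def
    by (subst Sum_any.expand_superset[of "{..<n}"], force, force,
        subst Prod_any.expand_superset[of "{..<n}"])
      (use z in \<open>auto, metis diff_0_eq_0 leI qbinom_0\<close>)
qed

lemma C_poly_step:
  assumes lam: "is_partition lam" "lam 0 = Suc r" and mu: "is_partition \<mu>" "\<mu> \<le> lam"
  shows "C_poly lam \<mu> =
    (if \<mu> \<le> remove_box lam then C_poly (remove_box lam) \<mu> else 0) +
    (if \<mu> 0 = Suc r
     then qvar ^ (part_size lam - part_size \<mu>) * C_poly (lam \<circ> Suc) (\<mu> \<circ> Suc) else 0)"
proof -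
  define a where "a = conj_part lam"
  define b where "b = conj_part \<mu>"
  note l = conj_part_less_iff[OF lam(1), folded a_def] and m = conj_part_less_iff[OF mu(1), folded b_def]
  have ba: "b i \<le> a i" for i
    using conj_part_mono[OF mu(1) lam(1) mu(2)] by (simp add: a_def b_def)
  have apos: "0 < a i" if "i < Suc r" for i using l that lam(2) by simp
  have mu0: "\<mu> 0 \<le> Suc r" using le_funD[OF mu(2), of 0] lam(2) by simp
  have b0: "b (Suc r) = 0" using conj_part_eq_0[OF mu(1) mu0] by (simp add: b_def)
  \<comment> \<open>\<open>P\<close> collects the columns before the last. As
    \<open>b (Suc r) = 0\<close>, the last column contributes a q-binomial but no power of
    q.\<close>
  define P where "P = qvar ^ (\<Sum>i<r. b (Suc i) * (a i - b i)) *
    (\<Prod>i<r. qbinom (a i - b (Suc i)) (a i - b i))"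
  have C: "C_poly lam \<mu> = P * qbinom (a r) (a r - b r)"
    using C_poly_eq[OF lam(1) mu, of "Suc r"] lam(2) by (simp add: P_def b0 flip: a_def b_def)
  note rb = remove_box[OF lam]
  have R: "\<mu> \<le> remove_box lam \<longleftrightarrow> b r < a r"
    using le_remove_box_iff[OF lam mu] by (simp add: a_def b_def)
  have C1: "C_poly (remove_box lam) \<mu> = P * qbinom (a r - 1) (a r - 1 - b r)"
    if "\<mu> \<le> remove_box lam"
    using C_poly_eq[OF rb(1) mu(1) that rb(3)] by (simp add: P_def b0 rb(2) flip: a_def b_def)
  have S: "\<mu> 0 = Suc r \<longleftrightarrow> 0 < b r"
    using m[of 0 r] mu0 by auto
  \<comment> \<open>Removing a row lowers every \<open>a i\<close> and \<open>b i\<close> by one.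
    The differences and the q-binomials for \<open>i < r\<close> stay the same, but the exponent
    loses the sum of \<open>a i - b i\<close> over \<open>i < r\<close>. The prefactor restores this
    and leaves the power for the last column that the q-Pascal rule requires.\<close>
  have C2: "qvar ^ (part_size lam - part_size \<mu>) * C_poly (lam \<circ> Suc) (\<mu> \<circ> Suc) =
      P * (qvar ^ (a r - b r) * qbinom (a r - 1) (a r - b r))" if "0 < b r"
  proof -
    have bpos: "0 < b i" if "i \<le> r" for i
      using antimonoD[OF conj_part_antimono[OF mu(1)] that] \<open>0 < b r\<close> by (simp add: b_def)
    have regroup: "x * w * (y * u * v) = (x * y) * u * (w * v)" for u v w x y :: "int poly"
      by (simp add: mult_ac)
    have "lam 1 \<le> lam 0" using is_partitionD[OF lam(1)] by simp
    then have l0: "(lam \<circ> Suc) 0 \<le> Suc r" using lam(2) by simp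
    have le: "\<mu> \<circ> Suc \<le> lam \<circ> Suc" using mu(2) by (simp add: le_fun_def)
    have sz: "part_size lam - part_size \<mu> = (\<Sum>i<r. a i - b i) + (a r - b r)"
      using part_size_conj[OF lam(1), of "Suc r"] part_size_conj[OF mu(1) mu0] lam(2) ba
      by (simp add: sum_subtractf_nat flip: a_def b_def) (simp add: sum_mono)
    have "C_poly (lam \<circ> Suc) (\<mu> \<circ> Suc) =
        qvar ^ (\<Sum>i<r. (b (Suc i) - 1) * (a i - b i)) *
        (\<Prod>i<r. qbinom (a i - b (Suc i)) (a i - b i)) * qbinom (a r - 1) (a r - b r)"
    proof -
      have 1: "a i - 1 - (b i - 1) = a i - b i" if "i < Suc r" for i
        using bpos[of i] that by simp
      have 2: "a i - 1 - (b (Suc i) - 1) = a i - b (Suc i)" if "i < r" for i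
        using bpos[of "Suc i"] that by simp
      have "(\<Sum>i<Suc r. (b (Suc i) - 1) * (a i - 1 - (b i - 1))) =
          (\<Sum>i<r. (b (Suc i) - 1) * (a i - b i))"
        using 1 by (simp add: b0)
      \<comment> \<open>At \<open>i = r\<close> the entry \<open>b (Suc r)\<close> is 0 and remains
        0, so the upper index of the last q-binomial does drop by one.\<close>
      moreover have "(\<Prod>i<Suc r. qbinom (a i - 1 - (b (Suc i) - 1)) (a i - 1 - (b i - 1))) =
          (\<Prod>i<r. qbinom (a i - b (Suc i)) (a i - b i)) * qbinom (a r - 1) (a r - b r)"
        using 1 2 by (simp add: b0)
      ultimately show ?thesis
        using C_poly_eq[OF is_partition_shift[OF lam(1)] is_partition_shift[OF mu(1)] le l0]
        unfolding conj_part_shift[OF lam(1)] conj_part_shift[OF mu(1)] a_def[symmetric] b_def[symmetric]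
        by (simp only: Suc_eq_plus1[symmetric] mult.assoc)
    qed
    moreover have "qvar ^ (\<Sum>i<r. a i - b i) * qvar ^ (\<Sum>i<r. (b (Suc i) - 1) * (a i - b i)) =
        qvar ^ (\<Sum>i<r. b (Suc i) * (a i - b i))"
    proof -
      have "(\<Sum>i<r. a i - b i) + (\<Sum>i<r. (b (Suc i) - 1) * (a i - b i)) =
          (\<Sum>i<r. b (Suc i) * (a i - b i))"
        unfolding sum.distrib[symmetric]
      proof (rule sum.cong[OF refl])
        fix i assume "i \<in> {..<r}"
        then obtain x where "b (Suc i) = Suc x" using bpos[of "Suc i"] by (auto simp: gr0_conv_Suc)
        then show "a i - b i + (b (Suc i) - 1) * (a i - b i) = b (Suc i) * (a i - b i)" by simp
      qed
      then show ?thesis by (simp flip: power_add)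
    qed
    ultimately show ?thesis
      unfolding sz power_add P_def using regroup by (simp only:)
  qed
  show ?thesis
  proof (cases "b r < a r \<and> 0 < b r")
    case True
    define n k where "n = a r - 1" and "k = a r - b r - 1"
    have "a r = Suc n" "a r - b r = Suc k" "a r - 1 - b r = k" "k < n"
      using True by (auto simp: n_def k_def)
    then show ?thesis
      using True qbinom_Suc_Suc[OF \<open>k < n\<close>] C C1 C2 R S by (simp add: distrib_left)
  next
    case False
    \<comment> \<open>At either end of the range only one of the two terms is present, and the
      q-binomials of the last column are 1.\<close>
    then consider "b r = 0" "b r < a r" | "b r = a r" "0 < b r"
      using ba[of r] apos[of r] by linarith
    then show ?thesis
      by cases (use C C1 C2 R S in auto)
  qed
qed

section \<open>Sums over subpartitions of a fixed size\<close>

definition subsum :: "(nat \<Rightarrow> nat) \<Rightarrow> int \<Rightarrow> int poly" where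
  "subsum lam k = (\<Sum>\<mu> | is_partition \<mu> \<and> int (part_size \<mu>) = k \<and> \<mu> \<le> lam. C_poly lam \<mu>)"

lemma finite_subpartitions_size:
  assumes "is_partition lam"
  shows "finite {\<mu>. is_partition \<mu> \<and> int (part_size \<mu>) = k \<and> \<mu> \<le> lam}"
  by (rule finite_subset[OF _ finite_subpartitions[OF assms]]) (auto simp: subpartitions_def)

lemma part_size_shift:
  assumes "is_partition lam"
  shows "part_size lam = lam 0 + part_size (lam \<circ> Suc)"
proof -
  have le: "(lam \<circ> Suc) 0 \<le> lam 0"
    using is_partitionD[OF assms] by simp
  have "part_size (lam \<circ> Suc) = (\<Sum>i<lam 0. conj_part lam i - 1)"
    using part_size_conj[OF is_partition_shift[OF assms] le] unfolding conj_part_shift[OF assms] .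
  moreover have "(\<Sum>i<lam 0. conj_part lam i) = (\<Sum>i<lam 0. (conj_part lam i - 1) + 1)"
    by (rule sum.cong) (use conj_part_less_iff[OF assms, of 0] in \<open>auto simp: Suc_le_eq\<close>)
  ultimately show ?thesis
    using part_size_conj[OF assms order.refl] unfolding sum.distrib by simp
qed

lemma is_partition_case_nat:
  assumes "is_partition \<mu>" "\<mu> 0 \<le> r"
  shows "is_partition (case_nat r \<mu>)"
proof -
  have "{i. case_nat r \<mu> i \<noteq> 0} \<subseteq> insert 0 (Suc ` {i. \<mu> i \<noteq> 0})"
  proof
    fix i assume "i \<in> {i. case_nat r \<mu> i \<noteq> 0}"
    then show "i \<in> insert 0 (Suc ` {i. \<mu> i \<noteq> 0})" by (cases i) auto
  qed
  moreover have "antimono (case_nat r \<mu>)"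
  proof (rule antimonoI)
    fix i j :: nat assume "i \<le> j"
    then show "case_nat r \<mu> j \<le> case_nat r \<mu> i"
      using is_partitionD[OF assms(1), of "i - 1" "j - 1"] is_partitionD[OF assms(1), of 0 "j - 1"] assms(2)
      by (auto split: nat.split)
  qed
  ultimately show ?thesis
    using assms(1) finite_subset unfolding is_partition_def by blast
qed

lemma subsum_step:
  assumes lam: "is_partition lam" "lam 0 = Suc r"
  shows "subsum lam k = subsum (remove_box lam) k +
    qvar ^ nat (int (part_size lam) - k) * subsum (lam \<circ> Suc) (k - int (Suc r))"
proof -
  let ?P = "\<lambda>lam k. {\<mu>. is_partition \<mu> \<and> int (part_size \<mu>) = k \<and> \<mu> \<le> lam}"
  note fin = finite_subpartitions_size[OF lam(1)]
  have rble: "remove_box lam \<le> lam"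
    using conj_part_less_iff[OF lam(1), of "conj_part lam r - 1" r]
      conj_part_less_iff[OF lam(1), of 0 r] lam(2)
    by (auto simp: remove_box_def le_fun_def)
  have 1: "{\<mu> \<in> ?P lam k. \<mu> \<le> remove_box lam} = ?P (remove_box lam) k"
    using rble by (auto intro: order.trans)
  \<comment> \<open>If the first row of \<mu> has full length, deleting it gives a subpartition of
    nu; prepending a row of length \<open>Suc r\<close> is the inverse.\<close>
  have "bij_betw (\<lambda>\<mu>. \<mu> \<circ> Suc) {\<mu> \<in> ?P lam k. \<mu> 0 = Suc r} (?P (lam \<circ> Suc) (k - int (Suc r)))"
  proof (rule bij_betwI[where g = "case_nat (Suc r)"])
    show "(\<lambda>\<mu>. \<mu> \<circ> Suc) \<in> {\<mu> \<in> ?P lam k. \<mu> 0 = Suc r} \<rightarrow> ?P (lam \<circ> Suc) (k - int (Suc r))"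
      using is_partition_shift by (auto simp: part_size_shift le_fun_def)
    show "case_nat (Suc r) \<in> ?P (lam \<circ> Suc) (k - int (Suc r)) \<rightarrow> {\<mu> \<in> ?P lam k. \<mu> 0 = Suc r}"
    proof
      fix \<mu> assume m: "\<mu> \<in> ?P (lam \<circ> Suc) (k - int (Suc r))"
      have "\<mu> 0 \<le> lam 1" using m by (auto simp: le_fun_def)
      also have "lam 1 \<le> Suc r" using is_partitionD[OF lam(1), of 0 1] lam(2) by simp
      finally have p: "is_partition (case_nat (Suc r) \<mu>)"
        using m is_partition_case_nat by simp
      have "case_nat (Suc r) \<mu> \<circ> Suc = \<mu>" by (simp add: fun_eq_iff)
      then show "case_nat (Suc r) \<mu> \<in> {\<mu> \<in> ?P lam k. \<mu> 0 = Suc r}"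
        using m p lam(2) part_size_shift[OF p] by (auto simp: le_fun_def split: nat.split)
    qed
  qed (auto simp: fun_eq_iff split: nat.split)
  then have 2: "(\<Sum>\<mu> | \<mu> \<in> ?P lam k \<and> \<mu> 0 = Suc r. C_poly (lam \<circ> Suc) (\<mu> \<circ> Suc)) =
      subsum (lam \<circ> Suc) (k - int (Suc r))"
    unfolding subsum_def by (rule sum.reindex_bij_betw)
  \<comment> \<open>Every \<mu> here has size \<open>k\<close>, so the exponent no longer depends on
    \<mu> and the power of q can leave the sum.\<close>
  have "subsum lam k = (\<Sum>\<mu>\<in>?P lam k.
      (if \<mu> \<le> remove_box lam then C_poly (remove_box lam) \<mu> else 0) +
      (if \<mu> 0 = Suc r
       then qvar ^ nat (int (part_size lam) - k) * C_poly (lam \<circ> Suc) (\<mu> \<circ> Suc) else 0))"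
    unfolding subsum_def
    by (rule sum.cong) (auto simp: C_poly_step[OF lam] nat_minus_as_int)
  also have "\<dots> = subsum (remove_box lam) k +
      (\<Sum>\<mu> | \<mu> \<in> ?P lam k \<and> \<mu> 0 = Suc r.
         qvar ^ nat (int (part_size lam) - k) * C_poly (lam \<circ> Suc) (\<mu> \<circ> Suc))"
    unfolding sum.distrib sum.inter_filter[OF fin, symmetric] 1 subsum_def[of "remove_box lam"] ..
  also have "\<dots> = subsum (remove_box lam) k +
      qvar ^ nat (int (part_size lam) - k) * subsum (lam \<circ> Suc) (k - int (Suc r))"
    unfolding sum_distrib_left[symmetric] 2 ..
  finally show ?thesis .
qed

section \<open>Identification with the column recurrence\<close>

lemma map_conj_Suc:
  "map (conj_part lam) (rev [0..<Suc n]) = conj_part lam n # map (conj_part lam) (rev [0..<n])"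
  by simp

lemma part_size_columns:
  assumes "is_partition lam" "lam 0 \<le> n"
  shows "sum_list (map (conj_part lam) (rev [0..<n])) = part_size lam"
proof -
  have "sum_list (map (conj_part lam) (rev [0..<n])) = (\<Sum>i<n. conj_part lam i)"
    by (induction n) (simp_all add: add.commute)
  then show ?thesis using part_size_conj[OF assms] by simp
qed

lemma sorted_columns:
  assumes "is_partition lam"
  shows "sorted (map (conj_part lam) (rev [0..<n]))"
  using antimonoD[OF conj_part_antimono[OF assms]]
  by (induction n) auto

text \<open>Both sides satisfy the same recurrence. Since lam- may acquire an empty last column,
  \<open>n\<close> is only a bound on the first part, and the induction is on \<open>n\<close> plus
  the size: a step drops an empty column or removes boxes.\<close>

lemma subsum_eq_subcount:
  assumes "is_partition lam" "lam 0 \<le> n"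
  shows "subsum lam k = subcount (map (conj_part lam) (rev [0..<n])) k"
  using assms
proof (induction "n + part_size lam" arbitrary: n lam k rule: less_induct)
  case less
  note lam = less(2)
  show ?case
  proof (cases n)
    case 0
    have z: "lam = (\<lambda>_. 0)"
      using is_partitionD[OF lam, of 0] less(3) 0 by (simp add: fun_eq_iff)
    have "{\<mu>. is_partition \<mu> \<and> int (part_size \<mu>) = k \<and> \<mu> \<le> lam} =
        (if k = 0 then {lam} else {})"
      using lam by (auto simp: z le_fun_def part_size_def simp flip: fun_eq_iff)
    then show ?thesis
      by (auto simp: subsum_def 0 C_poly_eq[OF lam lam order.refl less(3)])
  next
    case (Suc r)
    show ?thesis
    proof (cases "lam 0 = n")
      case False
      then have le: "lam 0 \<le> r" using less(3) Suc by simp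
      have "subsum lam k = subcount (map (conj_part lam) (rev [0..<r])) k"
        by (rule less(1)) (use Suc lam le in auto)
      then show ?thesis
        unfolding Suc map_conj_Suc conj_part_eq_0[OF lam le] by simp
    next
      case True
      then have l0: "lam 0 = Suc r" by (simp add: Suc)
      note rb = remove_box[OF lam l0]
      have "0 < conj_part lam r" using conj_part_less_iff[OF lam] l0 by simp
      then obtain c where c: "conj_part lam r = Suc c" by (auto simp: gr0_conv_Suc)
      have "lam 1 \<le> lam 0" using is_partitionD[OF lam] by simp
      then have sh0: "(lam \<circ> Suc) 0 \<le> n" using l0 Suc by simp
      have cols: "map (conj_part (remove_box lam)) (rev [0..<Suc r]) =
          c # map (conj_part lam) (rev [0..<r])"
        unfolding map_conj_Suc by (simp add: rb(2) c)
      have "part_size (remove_box lam) < part_size lam"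
        using part_size_columns[OF rb(1,3)] part_size_columns[OF lam, of "Suc r"] l0
        unfolding cols unfolding map_conj_Suc by (simp add: c)
      then have 1: "subsum (remove_box lam) k = subcount (c # map (conj_part lam) (rev [0..<r])) k"
        using less(1)[OF _ rb(1), of n k] rb(3) unfolding Suc cols by simp
      have "conj_part (lam \<circ> Suc) = (\<lambda>i. conj_part lam i - 1)"
        using conj_part_shift[OF lam] by blast
      then have cols': "map (conj_part (lam \<circ> Suc)) (rev [0..<Suc r]) =
          c # map (\<lambda>x. x - 1) (map (conj_part lam) (rev [0..<r]))"
        unfolding map_conj_Suc by (simp only: c) simp
      have "subsum (lam \<circ> Suc) (k - int n) =
          subcount (map (conj_part (lam \<circ> Suc)) (rev [0..<n])) (k - int n)"
        by (rule less(1)[OF _ is_partition_shift[OF lam] sh0])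
            (use part_size_shift[OF lam] l0 in linarith)
      then have 2: "subsum (lam \<circ> Suc) (k - int (Suc r)) =
          subcount (c # map (\<lambda>x. x - 1) (map (conj_part lam) (rev [0..<r]))) (k - int (Suc r))"
        unfolding Suc cols' .
      have 3: "part_size lam = sum_list (Suc c # map (conj_part lam) (rev [0..<r]))"
        using part_size_columns[OF lam, of "Suc r"] l0 unfolding map_conj_Suc c by simp
      show ?thesis
        unfolding Suc map_conj_Suc c subsum_step[OF lam l0] 1 2 3 subcount.simps by simp
    qed
  qed
qed

lemma coeff_C_genpoly:
  assumes "is_partition lam"
  shows "coeff (C_genpoly lam) i = subsum lam (int i)"
proof -
  have "{\<mu> \<in> subpartitions lam. part_size \<mu> = i} =
      {\<mu>. is_partition \<mu> \<and> int (part_size \<mu>) = int i \<and> \<mu> \<le> lam}"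
    by (auto simp: subpartitions_def)
  then show ?thesis
    by (simp add: C_genpoly_def coeff_sum subsum_def
        sum.inter_filter[OF finite_subpartitions[OF assms], symmetric])
qed

theorem theorem5:
  fixes m k :: nat and lam :: "nat \<Rightarrow> nat"
  assumes "is_partition lam" and "part_size lam = m"
  shows "(\<Sum>\<mu> | is_partition \<mu> \<and> part_size \<mu> = k \<and> \<mu> \<le> lam. C_poly lam \<mu>) =
         (\<Sum>\<mu> | is_partition \<mu> \<and> int (part_size \<mu>) = int m - int k \<and> \<mu> \<le> lam. C_poly lam \<mu>)
       \<and> (\<forall>i j. 0 \<le> coeff (coeff (C_genpoly lam) i) j)
       \<and> degree (C_genpoly lam) = m
       \<and> reflect_poly (C_genpoly lam) = C_genpoly lam"
proof -
  let ?cs = "map (conj_part lam) (rev [0..<lam 0])"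
  note eq = subsum_eq_subcount[OF assms(1) order.refl]
  note sorted = sorted_columns[OF assms(1), of "lam 0"]
  have sum: "sum_list ?cs = m"
    using part_size_columns[OF assms(1) order.refl] assms(2) by simp
  have sym: "subsum lam (int m - i) = subsum lam i" for i
    using subcount_sym[OF sorted] by (simp add: eq sum)
  note coeff = coeff_C_genpoly[OF assms(1)]
  \<comment> \<open>The empty subpartition contributes 1 at size 0; reflected, this is a nonzero
    coefficient at \<open>m\<close>, so the degree is exactly \<open>m\<close>.\<close>
  have top: "subsum lam (int m) = 1"
    using sym[of 0] subcount_0[OF sorted] by (simp add: eq)
  have zero: "subsum lam (int i) = 0" if "m < i" for i
    using subcount_eq_0[OF sorted] sum that by (simp add: eq)
  have deg: "degree (C_genpoly lam) = m"
    by (rule antisym) (use top zero in \<open>auto intro!: degree_le le_degree simp: coeff\<close>)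
  \<comment> \<open>\<open>reflect_poly\<close> reverses the coefficients about the actual degree,
    hence the degree has to be known first.\<close>
  have refl: "reflect_poly (C_genpoly lam) = C_genpoly lam"
    using zero sym by (intro poly_eqI) (auto simp: coeff_reflect_poly deg coeff of_nat_diff)
  show ?thesis
    using sym[of "int k"] deg refl by (auto simp: subsum_def[symmetric] coeff eq subcount_nonneg)
      (simp add: subsum_def flip: eq)
qed

end
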